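(* Let $P$ be a polymatroid on $[n]$ with rank function $f$. Then for any $k\in[n]$, $$x^{n-k}y^{k-1}[\mathscr{T}_P(x,y)]=\sum_{S\subset[n],\,|S|=k-1}f(S)+\sum_{S'\subset[n],\,|S'|=k}f(S')-\binom{n}{k-1}f([n])-k\binom{n}{k}.$$
   Context: A polymatroid on $[n]$ is $P=\{\mathbf a\in\mathbb{Z}^n\mid \sum_{i\in I}a_i\le f(I)\ \forall I,\ \sum_{i\in[n]}a_i=f([n])\}$ with $f(\emptyset)=0$, $f$ submodular (rank function). For $\mathbf a\in P$, $i$ is internally active if $\mathbf a-\mathbf e_i+\mathbf e_j\notin P$ for all $j<i$, externally active if $\mathbf a+\mathbf e_i-\mathbf e_j\notin P$ for all $j<i$; $\mathrm{Int}(\mathbf a),\mathrm{Ext}(\mathbf a)$ are these sets. $\mathscr{T}_P(x,y)=\sum_{\mathbf a\in P}x^{|\mathrm{Int}\setminus\mathrm{Ext}|}y^{|\mathrm{Ext}\setminus\mathrm{Int}|}(x+y-1)^{|\mathrm{Int}\cap\mathrm{Ext}|}$. $x^iy^j[g]$ denotes the coefficient of $x^iy^j$ in $g$. *)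

theory Defs
  imports "HOL-Computational_Algebra.Polynomial"
begin

text \<open>The ground set \<open>[n]\<close> is \<open>{1..n}\<close>; a point of \<open>\<int>\<^sup>n\<close> is a function \<open>nat \<Rightarrow> int\<close> vanishing outside
  \<open>{1..n}\<close>. Rank functions are integer valued and only their values on subsets of \<open>{1..n}\<close> matter.\<close>

definition lattice_points :: "nat \<Rightarrow> (nat \<Rightarrow> int) set" where
  "lattice_points n = {a. \<forall>i. i \<notin> {1..n} \<longrightarrow> a i = 0}"

definition unit_vec :: "nat \<Rightarrow> nat \<Rightarrow> int" where
  "unit_vec i = (\<lambda>l. if l = i then 1 else 0)"

definition rank_function :: "nat \<Rightarrow> (nat set \<Rightarrow> int) \<Rightarrow> bool" where
  "rank_function n f \<longleftrightarrow>
     f {} = 0 \<and>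
     (\<forall>I J. I \<subseteq> {1..n} \<longrightarrow> J \<subseteq> {1..n} \<longrightarrow> f (I \<union> J) + f (I \<inter> J) \<le> f I + f J)"

definition polymatroid :: "nat \<Rightarrow> (nat set \<Rightarrow> int) \<Rightarrow> (nat \<Rightarrow> int) set \<Rightarrow> bool" where
  "polymatroid n f P \<longleftrightarrow>
     rank_function n f \<and>
     P = {a \<in> lattice_points n.
            (\<forall>I. I \<subseteq> {1..n} \<longrightarrow> (\<Sum>i\<in>I. a i) \<le> f I) \<and> (\<Sum>i\<in>{1..n}. a i) = f {1..n}}"

definition internally_active :: "nat \<Rightarrow> (nat \<Rightarrow> int) set \<Rightarrow> (nat \<Rightarrow> int) \<Rightarrow> nat set" where
  "internally_active n P a =
     {i \<in> {1..n}. \<forall>j\<in>{1..n}. j < i \<longrightarrow> (\<lambda>l. a l - unit_vec i l + unit_vec j l) \<notin> P}"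

definition externally_active :: "nat \<Rightarrow> (nat \<Rightarrow> int) set \<Rightarrow> (nat \<Rightarrow> int) \<Rightarrow> nat set" where
  "externally_active n P a =
     {i \<in> {1..n}. \<forall>j\<in>{1..n}. j < i \<longrightarrow> (\<lambda>l. a l + unit_vec i l - unit_vec j l) \<notin> P}"

text \<open>Bivariate integer polynomials are elements of \<open>(\<int>[y])[x]\<close>: the outer variable is \<open>x\<close>, the
  inner one \<open>y\<close>.\<close>

definition var_x :: "int poly poly" where
  "var_x = [:0, 1:]"

definition var_y :: "int poly poly" where
  "var_y = [:[:0, 1:]:]"

definition xy_coeff :: "nat \<Rightarrow> nat \<Rightarrow> int poly poly \<Rightarrow> int" where
  "xy_coeff i j g = coeff (coeff g i) j"

definition tutte :: "nat \<Rightarrow> (nat \<Rightarrow> int) set \<Rightarrow> int poly poly" where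
  "tutte n P =
     (\<Sum>a\<in>P.
        var_x ^ card (internally_active n P a - externally_active n P a) *
        var_y ^ card (externally_active n P a - internally_active n P a) *
        (var_x + var_y - 1) ^ card (internally_active n P a \<inter> externally_active n P a))"

text \<open>The sum defining \<open>tutte\<close> is over a finite set (otherwise \<open>sum\<close> would silently be \<open>0\<close>).\<close>

lemma finite_polymatroid:
  assumes "polymatroid n f P"
  shows "finite P"
proof -
  define B where "B = (\<Sum>i\<in>{1..n}. \<bar>f {i}\<bar>) + \<bar>f {1..n}\<bar>"
  have "P \<subseteq> {a. \<forall>i. (i \<in> {1..n} \<longrightarrow> a i \<in> {-B..B}) \<and> (i \<notin> {1..n} \<longrightarrow> a i = 0)}"
  proof (intro subsetI CollectI allI conjI impI)
    fix a i assume a: "a \<in> P" and i: "i \<in> {1..n}"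
    have ub: "a j \<le> \<bar>f {j}\<bar>" if "j \<in> {1..n}" for j
    proof -
      have "(\<Sum>l\<in>{j}. a l) \<le> f {j}"
        using assms a that unfolding polymatroid_def by blast
      then show ?thesis by simp
    qed
    have tot: "(\<Sum>j\<in>{1..n}. a j) = f {1..n}"
      using assms a unfolding polymatroid_def by blast
    have s1: "(\<Sum>j\<in>{1..n}. a j) = a i + (\<Sum>j\<in>{1..n}-{i}. a j)"
      using i by (simp add: sum.remove)
    have s2: "(\<Sum>j\<in>{1..n}. \<bar>f {j}\<bar>) = \<bar>f {i}\<bar> + (\<Sum>j\<in>{1..n}-{i}. \<bar>f {j}\<bar>)"
      using i by (simp add: sum.remove)
    have s3: "(\<Sum>j\<in>{1..n}-{i}. a j) \<le> (\<Sum>j\<in>{1..n}-{i}. \<bar>f {j}\<bar>)"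
      by (intro sum_mono ub) auto
    have s4: "0 \<le> (\<Sum>j\<in>{1..n}-{i}. \<bar>f {j}\<bar>)"
      by (intro sum_nonneg) auto
    have "-B \<le> a i" "a i \<le> B"
      using ub[OF i] tot s1 s2 s3 s4 unfolding B_def by linarith+
    then show "a i \<in> {-B..B}"
      by simp
  next
    fix a i assume "a \<in> P" "i \<notin> {1..n}"
    then show "a i = 0"
      using assms unfolding polymatroid_def lattice_points_def by blast
  qed
  then show ?thesis
    by (rule finite_subset) (intro finite_set_of_finite_funs; simp)
qed

end

theory Submission
  imports Defs
begin

text \<open>
  Slice \<open>P\<close> by the value \<open>t\<close> of the last coordinate, \<open>lo \<le> t \<le> hi\<close>. Each slice is a polymatroid in one
  variable less, and since activity only involves exchanges with smaller indices, the activity of the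
  other indices is the same in the slice as in \<open>P\<close>. The last index is internally active iff \<open>t = lo\<close> and
  externally active iff \<open>t = hi\<close>, because tight sets are closed under unions and intersections. Hence
  the polynomial of \<open>P\<close> is \<open>x T\<^sub>l\<^sub>o + y T\<^sub>h\<^sub>i + (\<Sum>lo<t<hi. T\<^sub>t)\<close>, minus \<open>T\<^sub>l\<^sub>o\<close> when \<open>lo = hi\<close>. By induction
  the coefficients of total degree above \<open>n\<close> vanish, those of degree \<open>n\<close> are the binomial
  coefficients, and those of degree \<open>n - 1\<close> satisfy the recursion of the claimed formula.
\<close>

subsection \<open>Tight sets\<close>

lemma polymatroidD:
  assumes "polymatroid n f P"
  shows "f {} = 0"
    and "I \<subseteq> {1..n} \<Longrightarrow> J \<subseteq> {1..n} \<Longrightarrow> f (I \<union> J) + f (I \<inter> J) \<le> f I + f J"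
    and "a \<in> P \<longleftrightarrow> a \<in> lattice_points n \<and> (\<forall>I. I \<subseteq> {1..n} \<longrightarrow> sum a I \<le> f I) \<and> sum a {1..n} = f {1..n}"
  using assms unfolding polymatroid_def rank_function_def by auto

text \<open>Submodularity squeezes: \<open>f T + f U = sum a (T \<union> U) + sum a (T \<inter> U)
  \<le> f (T \<union> U) + f (T \<inter> U) \<le> f T + f U\<close>, so both constraints hold with
  equality.\<close>

lemma tight_Un_Int:
  assumes P: "polymatroid n f P" and a: "a \<in> P"
    and T: "T \<subseteq> {1..n}" "sum a T = f T" and U: "U \<subseteq> {1..n}" "sum a U = f U"
  shows "sum a (T \<union> U) = f (T \<union> U)" "sum a (T \<inter> U) = f (T \<inter> U)"
proof -
  have "sum a (T \<union> U) + sum a (T \<inter> U) = sum a T + sum a U"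
    using T U by (metis sum.union_inter finite_atLeastAtMost finite_subset)
  moreover have "sum a (T \<union> U) \<le> f (T \<union> U)" "sum a (T \<inter> U) \<le> f (T \<inter> U)"
    using polymatroidD(3)[OF P] a T U by (metis Un_least, metis le_infI1)
  moreover have "f (T \<union> U) + f (T \<inter> U) \<le> f T + f U"
    using polymatroidD(2)[OF P] T U by blast
  ultimately show "sum a (T \<union> U) = f (T \<union> U)" "sum a (T \<inter> U) = f (T \<inter> U)"
    using T U by linarith+
qed

lemma sum_exchange:
  assumes "finite I"
  shows "(\<Sum>l\<in>I. a l - unit_vec i l + unit_vec j l) =
    sum a I - (if i \<in> I then 1 else 0) + (if j \<in> I then 1 else 0)"
  using assms by (simp add: sum.distrib sum_subtractf unit_vec_def)

text \<open>The exchange raises \<open>sum a I\<close> by at most one, and does so exactly when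
  \<open>j \<in> I\<close> and \<open>i \<notin> I\<close>. By integrality it can only violate a
  constraint that is already tight.\<close>

lemma exchange_mem_iff:
  assumes P: "polymatroid n f P" and a: "a \<in> P" and ij: "i \<in> {1..n}" "j \<in> {1..n}"
  shows "(\<lambda>l. a l - unit_vec i l + unit_vec j l) \<notin> P \<longleftrightarrow>
    (\<exists>T \<subseteq> {1..n}. sum a T = f T \<and> j \<in> T \<and> i \<notin> T)"
proof -
  let ?b = "\<lambda>l. a l - unit_vec i l + unit_vec j l"
  note sum_b = sum_exchange[of _ a i j, OF finite_subset[OF _ finite_atLeastAtMost]]
  have le: "sum a I \<le> f I" if "I \<subseteq> {1..n}" for I
    using that a polymatroidD(3)[OF P] by blast
  have "?b \<in> lattice_points n"
    using a ij polymatroidD(3)[OF P, of a] unfolding lattice_points_def unit_vec_def by auto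
  moreover have "sum ?b {1..n} = f {1..n}"
    using sum_b[of "{1..n}" 1 n] a ij polymatroidD(3)[OF P, of a] by simp
  ultimately have "?b \<notin> P \<longleftrightarrow> (\<exists>I\<subseteq>{1..n}. sum ?b I > f I)"
    unfolding polymatroidD(3)[OF P, of ?b] by (auto simp: not_le)
  also have "\<dots> \<longleftrightarrow> (\<exists>T \<subseteq> {1..n}. sum a T = f T \<and> j \<in> T \<and> i \<notin> T)"
  proof (intro ex_cong1 conj_cong refl)
    fix I assume "I \<subseteq> {1..n}"
    then show "sum ?b I > f I \<longleftrightarrow> sum a I = f I \<and> j \<in> I \<and> i \<notin> I"
      using sum_b[of I 1 n] le[of I] by auto
  qed
  finally show ?thesis .
qed

section \<open>Activity of the last index\<close>

text \<open>Internal activity gives, for every \<open>j\<close> in \<open>{1..n}\<close>, a tight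
  set containing \<open>j\<close> but not \<open>Suc n\<close>; the union of these is
  \<open>{1..n}\<close>. Conversely, a tight \<open>{1..n}\<close> blocks every exchange at
  once.\<close>

lemma last_internally_active_iff:
  assumes P: "polymatroid (Suc n) f P" and a: "a \<in> P"
  shows "Suc n \<in> internally_active (Suc n) P a \<longleftrightarrow> sum a {1..n} = f {1..n}"
proof
  assume L: "Suc n \<in> internally_active (Suc n) P a"
  \<comment> \<open>The tight sets are merged one \<open>j\<close> at a time, starting from the
    empty set, which is tight because \<open>f {} = 0\<close>.\<close>
  have "\<exists>T\<subseteq>{1..Suc n}. sum a T = f T \<and> J \<subseteq> T \<and> Suc n \<notin> T" if "finite J" "J \<subseteq> {1..n}" for J
    using that
  proof (induction J rule: finite_induct)
    case empty
    then show ?case using polymatroidD(1)[OF P] by (intro exI[of _ "{}"]) auto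
  next
    case (insert j J)
    then obtain T where T: "T\<subseteq>{1..Suc n}" "sum a T = f T" "J \<subseteq> T" "Suc n \<notin> T"
      by auto
    have "(\<lambda>l. a l - unit_vec (Suc n) l + unit_vec j l) \<notin> P"
      using L insert.prems unfolding internally_active_def by auto
    then obtain U where U: "U\<subseteq>{1..Suc n}" "sum a U = f U" "j \<in> U" "Suc n \<notin> U"
      using exchange_mem_iff[OF P a, of "Suc n" j] insert.prems by auto
    have "sum a (T \<union> U) = f (T \<union> U)"
      using tight_Un_Int(1)[OF P a] T U by blast
    then show ?case
      using T U by (intro exI[of _ "T \<union> U"]) auto
  qed
  from this[of "{1..n}"] obtain T where T: "T\<subseteq>{1..Suc n}" "sum a T = f T" "{1..n} \<subseteq> T" "Suc n \<notin> T"
    by auto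
  then have "T = {1..n}" by (auto simp: le_Suc_eq)
  then show "sum a {1..n} = f {1..n}" using T by simp
next
  assume "sum a {1..n} = f {1..n}"
  then have "(\<lambda>l. a l - unit_vec (Suc n) l + unit_vec j l) \<notin> P" if "j \<in> {1..n}" for j
    using that by (subst exchange_mem_iff[OF P a]) (auto intro!: exI[of _ "{1..n}"])
  then show "Suc n \<in> internally_active (Suc n) P a"
    unfolding internally_active_def by auto
qed

text \<open>Dual to the internal case: the tight sets contain \<open>Suc n\<close> and avoid
  \<open>j\<close>, and their intersection is \<open>{Suc n}\<close>. The induction starts from the
  full ground set, which is tight for every point of \<open>P\<close>.\<close>

lemma last_externally_active_iff:
  assumes P: "polymatroid (Suc n) f P" and a: "a \<in> P"
  shows "Suc n \<in> externally_active (Suc n) P a \<longleftrightarrow> a (Suc n) = f {Suc n}"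
proof -
  \<comment> \<open>An external exchange is an internal one with the two indices interchanged, so
    \<open>exchange_mem_iff\<close> applies to it.\<close>
  have swap: "(\<lambda>l. a l + unit_vec i l - unit_vec j l) = (\<lambda>l. a l - unit_vec j l + unit_vec i l)" for i j
    by auto
  show ?thesis
  proof
    assume L: "Suc n \<in> externally_active (Suc n) P a"
    have "\<exists>T\<subseteq>{1..Suc n}. sum a T = f T \<and> J \<inter> T = {} \<and> Suc n \<in> T" if "finite J" "J \<subseteq> {1..n}" for J
      using that
    proof (induction J rule: finite_induct)
      case empty
      then show ?case
        using polymatroidD(3)[OF P, of a] a by (intro exI[of _ "{1..Suc n}"]) auto
    next
      case (insert j J)
      then obtain T where T: "T\<subseteq>{1..Suc n}" "sum a T = f T" "J \<inter> T = {}" "Suc n \<in> T"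
        by auto
      have "(\<lambda>l. a l - unit_vec j l + unit_vec (Suc n) l) \<notin> P"
        using L insert.prems unfolding externally_active_def swap by auto
      then obtain U where U: "U\<subseteq>{1..Suc n}" "sum a U = f U" "Suc n \<in> U" "j \<notin> U"
        using exchange_mem_iff[OF P a, of j "Suc n"] insert.prems by auto
      have "sum a (T \<inter> U) = f (T \<inter> U)"
        using tight_Un_Int(2)[OF P a] T U by blast
      then show ?case
        using T U by (intro exI[of _ "T \<inter> U"]) auto
    qed
    from this[of "{1..n}"] obtain T
      where T: "T\<subseteq>{1..Suc n}" "sum a T = f T" "{1..n} \<inter> T = {}" "Suc n \<in> T"
      by auto
    have "T = {Suc n}"
      using T by (fastforce simp: le_Suc_eq)
    then show "a (Suc n) = f {Suc n}" using T by simp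
  next
    assume "a (Suc n) = f {Suc n}"
    then have "(\<lambda>l. a l - unit_vec j l + unit_vec (Suc n) l) \<notin> P" if "j \<in> {1..n}" for j
      using that by (subst exchange_mem_iff[OF P a]) (auto intro!: exI[of _ "{Suc n}"])
    then show "Suc n \<in> externally_active (Suc n) P a"
      unfolding externally_active_def swap by auto
  qed
qed

subsection \<open>Slices\<close>

text \<open>The last coordinate is reset to 0, so that a slice lives in
  \<open>lattice_points n\<close>; writing \<open>t\<close> back recovers the point of
  \<open>P\<close>.\<close>

definition slice :: "nat \<Rightarrow> (nat \<Rightarrow> int) set \<Rightarrow> int \<Rightarrow> (nat \<Rightarrow> int) set" where
  "slice n P t = {b \<in> lattice_points n. b(Suc n := t) \<in> P}"

text \<open>Once the last coordinate is \<open>t\<close>, both \<open>I\<close> and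
  \<open>insert (Suc n) I\<close> bound the sum over \<open>I\<close>; the minimum is the sharper
  bound.\<close>

definition slice_rank :: "nat \<Rightarrow> (nat set \<Rightarrow> int) \<Rightarrow> int \<Rightarrow> nat set \<Rightarrow> int" where
  "slice_rank n f t I = min (f I) (f (insert (Suc n) I) - t)"

definition lo :: "nat \<Rightarrow> (nat set \<Rightarrow> int) \<Rightarrow> int" where
  "lo n f = f {1..Suc n} - f {1..n}"

definition hi :: "nat \<Rightarrow> (nat set \<Rightarrow> int) \<Rightarrow> int" where
  "hi n f = f {Suc n}"

lemma insert_Suc_atLeastAtMost: "insert (Suc n) {1..n} = {1..Suc n}"
  by auto

text \<open>Since \<open>J\<close> misses \<open>Suc n\<close>, the intersection loses it. This
  mixed case yields \<open>lo \<le> hi\<close>, enters the submodularity of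
  \<open>slice_rank\<close>, and decides its minimum at both ends.\<close>

lemma submodular_insert:
  assumes "polymatroid (Suc n) f P" "I \<subseteq> {1..n}" "J \<subseteq> {1..n}"
  shows "f (insert (Suc n) (I \<union> J)) + f (I \<inter> J) \<le> f (insert (Suc n) I) + f J"
proof -
  have "f (insert (Suc n) I \<union> J) + f (insert (Suc n) I \<inter> J) \<le> f (insert (Suc n) I) + f J"
    using assms by (intro polymatroidD(2)[OF assms(1)]) auto
  moreover have "insert (Suc n) I \<inter> J = I \<inter> J" using assms by auto
  ultimately show ?thesis by simp
qed

lemma submodular_insert2:
  assumes "polymatroid (Suc n) f P" "I \<subseteq> {1..n}" "J \<subseteq> {1..n}"
  shows "f (insert (Suc n) (I \<union> J)) + f (insert (Suc n) (I \<inter> J)) \<le>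
    f (insert (Suc n) I) + f (insert (Suc n) J)"
proof -
  have "f (insert (Suc n) I \<union> insert (Suc n) J) + f (insert (Suc n) I \<inter> insert (Suc n) J) \<le>
      f (insert (Suc n) I) + f (insert (Suc n) J)"
    using assms by (intro polymatroidD(2)[OF assms(1)]) auto
  then show ?thesis by simp
qed

lemma lo_le_hi:
  assumes "polymatroid (Suc n) f P"
  shows "lo n f \<le> hi n f"
  using submodular_insert[OF assms, of "{}" "{1..n}"] polymatroidD(1)[OF assms]
  by (simp add: lo_def hi_def insert_Suc_atLeastAtMost del: One_nat_def)

lemma last_coordinate_bounds:
  assumes P: "polymatroid (Suc n) f P" and a: "a \<in> P"
  shows "a (Suc n) \<in> {lo n f..hi n f}"
proof -
  have tot: "sum a {1..Suc n} = f {1..Suc n}" and le: "\<And>I. I \<subseteq> {1..Suc n} \<Longrightarrow> sum a I \<le> f I"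
    using a polymatroidD(3)[OF P, of a] by blast+
  have "sum a {1..n} \<le> f {1..n}" "sum a {Suc n} \<le> f {Suc n}"
    by (intro le; auto)+
  then show ?thesis using tot by (simp add: lo_def hi_def)
qed

text \<open>The bound \<open>t \<le> hi\<close> makes \<open>slice_rank\<close> vanish on the empty
  set, and \<open>lo \<le> t\<close> makes its value on \<open>{1..n}\<close> the total
  \<open>f {1..Suc n} - t\<close> of the slice.\<close>

lemma polymatroid_slice:
  assumes P: "polymatroid (Suc n) f P" and t: "t \<in> {lo n f..hi n f}"
  shows "polymatroid n (slice_rank n f t) (slice n P t)"
proof -
  let ?g = "slice_rank n f t"
  have g_empty: "?g {} = 0"
    using t polymatroidD(1)[OF P] by (simp add: slice_rank_def hi_def)
  have g_full: "?g {1..n} = f {1..Suc n} - t"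
    using t by (simp add: slice_rank_def lo_def insert_Suc_atLeastAtMost del: One_nat_def)
  \<comment> \<open>Four cases, according to which term attains the minimum at \<open>I\<close> and
    at \<open>J\<close>; each has its own instance of submodularity of \<open>f\<close>.\<close>
  have submod: "?g (I \<union> J) + ?g (I \<inter> J) \<le> ?g I + ?g J" if "I \<subseteq> {1..n}" "J \<subseteq> {1..n}" for I J
  proof -
    have "f (I \<union> J) + f (I \<inter> J) \<le> f I + f J"
      using that by (intro polymatroidD(2)[OF P]) auto
    moreover have "f (insert (Suc n) (I \<union> J)) + f (I \<inter> J) \<le> f (insert (Suc n) I) + f J"
      using that by (intro submodular_insert[OF P])
    moreover have "f (insert (Suc n) (I \<union> J)) + f (I \<inter> J) \<le> f (insert (Suc n) J) + f I"
      using submodular_insert[OF P that(2,1)] by (simp only: Un_commute Int_commute)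
    moreover have "f (insert (Suc n) (I \<union> J)) + f (insert (Suc n) (I \<inter> J)) \<le>
        f (insert (Suc n) I) + f (insert (Suc n) J)"
      using that by (intro submodular_insert2[OF P])
    ultimately show ?thesis
      unfolding slice_rank_def by linarith
  qed
  have mem: "b(Suc n := t) \<in> P \<longleftrightarrow>
      (\<forall>I. I \<subseteq> {1..n} \<longrightarrow> sum b I \<le> ?g I) \<and> sum b {1..n} = ?g {1..n}" if b: "b \<in> lattice_points n" for b
  proof -
    let ?a = "b(Suc n := t)"
    have s1: "sum ?a I = sum b I" if "I \<subseteq> {1..n}" for I
      using that by (intro sum.cong) auto
    have s2: "sum ?a (insert (Suc n) I) = sum b I + t" if "I \<subseteq> {1..n}" for I
    proof -
      have "Suc n \<notin> I" "finite I" using that finite_subset by auto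
      then show ?thesis using s1[OF that] by simp
    qed
    have "?a \<in> lattice_points (Suc n)"
      using b by (auto simp: lattice_points_def)
    moreover have "sum ?a {1..Suc n} = sum b {1..n} + t"
      using s2[of "{1..n}"] by (simp only: insert_Suc_atLeastAtMost subset_refl)
    moreover have "(\<forall>I. I \<subseteq> {1..Suc n} \<longrightarrow> sum ?a I \<le> f I) \<longleftrightarrow>
      (\<forall>I. I \<subseteq> {1..n} \<longrightarrow> sum b I \<le> f I \<and> sum b I \<le> f (insert (Suc n) I) - t)" (is "?L \<longleftrightarrow> ?R")
    proof
      assume L: ?L
      show ?R
      proof (intro allI impI conjI)
        fix I assume I: "I \<subseteq> {1..n}"
        have "sum ?a I \<le> f I"
          using I by (intro L[rule_format]) auto
        then show "sum b I \<le> f I" using s1[OF I] by simp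
        have "sum ?a (insert (Suc n) I) \<le> f (insert (Suc n) I)"
          using I by (intro L[rule_format]) auto
        then show "sum b I \<le> f (insert (Suc n) I) - t" using s2[OF I] by simp
      qed
    next
      assume R: ?R
      show ?L
      proof (intro allI impI)
        fix I assume I: "I \<subseteq> {1..Suc n}"
        \<comment> \<open>Every constraint of \<open>P\<close> belongs to \<open>J\<close> or to
          \<open>insert (Suc n) J\<close> for some \<open>J\<close> in \<open>{1..n}\<close>, so the
          paired bounds cover them all.\<close>
        define J where "J = I - {Suc n}"
        have J: "J \<subseteq> {1..n}" using I by (auto simp: J_def le_Suc_eq)
        have "I = J \<or> I = insert (Suc n) J" by (auto simp: J_def)
        moreover have "sum ?a J \<le> f J" "sum ?a (insert (Suc n) J) \<le> f (insert (Suc n) J)"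
          unfolding s1[OF J] s2[OF J] using R[rule_format, OF J] by auto
        ultimately show "sum ?a I \<le> f I" by (elim disjE) (simp_all only:)
      qed
    qed
    moreover have "?R \<longleftrightarrow> (\<forall>I. I \<subseteq> {1..n} \<longrightarrow> sum b I \<le> ?g I)"
      by (simp add: slice_rank_def)
    moreover have "sum b {1..n} + t = f {1..Suc n} \<longleftrightarrow> sum b {1..n} = ?g {1..n}"
      unfolding g_full by linarith
    ultimately show ?thesis
      using polymatroidD(3)[OF P, of ?a] by (simp only: simp_thms)
  qed
  have "slice n P t = {b \<in> lattice_points n.
      (\<forall>I. I \<subseteq> {1..n} \<longrightarrow> sum b I \<le> ?g I) \<and> sum b {1..n} = ?g {1..n}}"
    unfolding slice_def using mem by blast
  then show ?thesis
    unfolding polymatroid_def rank_function_def using g_empty submod by blast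
qed

section \<open>Activity in a slice\<close>

lemma internally_active_slice:
  assumes P: "polymatroid (Suc n) f P" and b: "b \<in> slice n P t"
  shows "internally_active (Suc n) P (b(Suc n := t)) =
    (if t = lo n f then {Suc n} else {}) \<union> internally_active n (slice n P t) b"
proof -
  let ?a = "b(Suc n := t)"
  have aP: "?a \<in> P" and bL: "b \<in> lattice_points n"
    using b by (auto simp: slice_def)
  have "(\<lambda>l. ?a l - unit_vec i l + unit_vec j l) \<in> P \<longleftrightarrow>
      (\<lambda>l. b l - unit_vec i l + unit_vec j l) \<in> slice n P t" if "i \<in> {1..n}" "j \<in> {1..n}" for i j
  proof -
    \<comment> \<open>Exchanges within \<open>{1..n}\<close> leave the last coordinate at
      \<open>t\<close>, so they can be tested inside the slice.\<close>
    have "(\<lambda>l. b l - unit_vec i l + unit_vec j l)(Suc n := t) = (\<lambda>l. ?a l - unit_vec i l + unit_vec j l)"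
      using that by (auto simp: unit_vec_def)
    then show ?thesis
      using bL that by (auto simp: slice_def lattice_points_def unit_vec_def)
  qed
  \<comment> \<open>Activity of \<open>i\<close> only tests \<open>j < i\<close>, so for
    \<open>i \<le> n\<close> the index \<open>Suc n\<close> never takes part.\<close>
  then have "i \<in> internally_active (Suc n) P ?a \<longleftrightarrow> i \<in> internally_active n (slice n P t) b"
    if "i \<noteq> Suc n" for i
    using that by (auto simp: internally_active_def)
  moreover have "Suc n \<notin> internally_active n (slice n P t) b"
    by (simp add: internally_active_def)
  moreover have "Suc n \<in> internally_active (Suc n) P ?a \<longleftrightarrow> t = lo n f"
  proof -
    \<comment> \<open>As the total is fixed, tightness of \<open>{1..n}\<close> is the same as
      \<open>t = lo n f\<close>.\<close>
    have "sum ?a {1..Suc n} = f {1..Suc n}"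
      using aP polymatroidD(3)[OF P, of ?a] by blast
    then show ?thesis
      unfolding last_internally_active_iff[OF P aP] by (auto simp: lo_def)
  qed
  ultimately have "i \<in> internally_active (Suc n) P ?a \<longleftrightarrow>
      i \<in> (if t = lo n f then {Suc n} else {}) \<union> internally_active n (slice n P t) b" for i
    by (cases "i = Suc n") simp_all
  then show ?thesis by blast
qed

lemma externally_active_slice:
  assumes P: "polymatroid (Suc n) f P" and b: "b \<in> slice n P t"
  shows "externally_active (Suc n) P (b(Suc n := t)) =
    (if t = hi n f then {Suc n} else {}) \<union> externally_active n (slice n P t) b"
proof -
  let ?a = "b(Suc n := t)"
  have aP: "?a \<in> P" and bL: "b \<in> lattice_points n"
    using b by (auto simp: slice_def)
  have "(\<lambda>l. ?a l + unit_vec i l - unit_vec j l) \<in> P \<longleftrightarrow>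
      (\<lambda>l. b l + unit_vec i l - unit_vec j l) \<in> slice n P t" if "i \<in> {1..n}" "j \<in> {1..n}" for i j
  proof -
    have "(\<lambda>l. b l + unit_vec i l - unit_vec j l)(Suc n := t) = (\<lambda>l. ?a l + unit_vec i l - unit_vec j l)"
      using that by (auto simp: unit_vec_def)
    then show ?thesis
      using bL that by (auto simp: slice_def lattice_points_def unit_vec_def)
  qed
  then have "i \<in> externally_active (Suc n) P ?a \<longleftrightarrow> i \<in> externally_active n (slice n P t) b"
    if "i \<noteq> Suc n" for i
    using that by (auto simp: externally_active_def)
  moreover have "Suc n \<notin> externally_active n (slice n P t) b"
    by (simp add: externally_active_def)
  moreover have "Suc n \<in> externally_active (Suc n) P ?a \<longleftrightarrow> t = hi n f"
    unfolding last_externally_active_iff[OF P aP] by (simp add: hi_def)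
  ultimately have "i \<in> externally_active (Suc n) P ?a \<longleftrightarrow>
      i \<in> (if t = hi n f then {Suc n} else {}) \<union> externally_active n (slice n P t) b" for i
    by (cases "i = Suc n") simp_all
  then show ?thesis by blast
qed

section \<open>Slicing recursion for the polynomial\<close>

text \<open>The summand of \<open>tutte\<close> for arbitrary sets, which isolates the effect of one
  further active index from the polymatroid.\<close>

definition weight :: "'a set \<Rightarrow> 'a set \<Rightarrow> int poly poly" where
  "weight A B = var_x ^ card (A - B) * var_y ^ card (B - A) * (var_x + var_y - 1) ^ card (A \<inter> B)"

text \<open>The new index enters at most one of \<open>A - B\<close>, \<open>B - A\<close> and
  \<open>A \<inter> B\<close>, so at most one exponent grows by one.\<close>

lemma weight_insert:
  assumes "finite A" "finite B" "m \<notin> A" "m \<notin> B"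
  shows "weight ((if p then {m} else {}) \<union> A) ((if q then {m} else {}) \<union> B) =
    (if p then if q then var_x + var_y - 1 else var_x else if q then var_y else 1) * weight A B"
  using assms by (auto simp: weight_def insert_Diff_if algebra_simps)

lemma tutte_slice_sum:
  assumes P: "polymatroid (Suc n) f P"
  shows "tutte (Suc n) P = (\<Sum>t = lo n f..hi n f.
    (if t = lo n f then if t = hi n f then var_x + var_y - 1 else var_x
     else if t = hi n f then var_y else 1) * tutte n (slice n P t))" (is "_ = (\<Sum>t = _.._. ?w t * _)")
proof -
  let ?W = "\<lambda>n P a. weight (internally_active n P a) (externally_active n P a)"
  have fin: "finite P" by (rule finite_polymatroid[OF P])
  have "tutte (Suc n) P = (\<Sum>a\<in>P. ?W (Suc n) P a)"
    by (simp add: tutte_def weight_def)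
  also have "\<dots> = (\<Sum>t = lo n f..hi n f. \<Sum>a\<in>{a \<in> P. a (Suc n) = t}. ?W (Suc n) P a)"
    using last_coordinate_bounds[OF P] by (intro sum.group[symmetric] fin) auto
  also have "\<dots> = (\<Sum>t = lo n f..hi n f. ?w t * tutte n (slice n P t))"
  proof (rule sum.cong[OF refl])
    fix t
    have "(\<Sum>a\<in>{a \<in> P. a (Suc n) = t}. ?W (Suc n) P a) = (\<Sum>b\<in>slice n P t. ?w t * ?W n (slice n P t) b)"
    \<comment> \<open>Resetting the last coordinate to 0 and writing \<open>t\<close> back are
      mutually inverse between the fibre over \<open>t\<close> and the slice.\<close>
    proof (rule sum.reindex_bij_witness[where i = "\<lambda>b. b(Suc n := t)" and j = "\<lambda>a. a(Suc n := 0)"])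
      fix b assume b: "b \<in> slice n P t"
      show "b(Suc n := t) \<in> {a \<in> P. a (Suc n) = t}" "b(Suc n := t, Suc n := 0) = b"
        using b by (auto simp: slice_def lattice_points_def)
    next
      fix a assume a: "a \<in> {a \<in> P. a (Suc n) = t}"
      then have upd: "a(Suc n := 0, Suc n := t) = a" by auto
      moreover have "a(Suc n := 0) \<in> lattice_points n"
        using a polymatroidD(3)[OF P, of a] by (auto simp: lattice_points_def)
      ultimately show b: "a(Suc n := 0) \<in> slice n P t"
        using a by (auto simp: slice_def)
      show "a(Suc n := 0, Suc n := t) = a" by (fact upd)
      have "?W (Suc n) P (a(Suc n := 0, Suc n := t)) = ?w t * ?W n (slice n P t) (a(Suc n := 0))"
        unfolding internally_active_slice[OF P b] externally_active_slice[OF P b]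
        by (rule weight_insert) (auto simp: internally_active_def externally_active_def)
      then show "?w t * ?W n (slice n P t) (a(Suc n := 0)) = ?W (Suc n) P a"
        unfolding upd by (rule sym)
    qed
    then show "(\<Sum>a\<in>{a \<in> P. a (Suc n) = t}. ?W (Suc n) P a) = ?w t * tutte n (slice n P t)"
      unfolding tutte_def weight_def sum_distrib_left .
  qed
  finally show ?thesis .
qed

text \<open>If \<open>lo = hi\<close>, both end terms refer to the same slice and the open interval
  is empty; the subtracted term then turns \<open>x + y\<close> into \<open>x + y - 1\<close>. This
  form treats both cases uniformly when coefficients are taken.\<close>

lemma tutte_slice:
  assumes P: "polymatroid (Suc n) f P"
  shows "tutte (Suc n) P =
    var_x * tutte n (slice n P (lo n f)) + var_y * tutte n (slice n P (hi n f))
    + (\<Sum>t\<in>{lo n f<..<hi n f}. tutte n (slice n P t))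
    - (if lo n f = hi n f then tutte n (slice n P (lo n f)) else 0)"
proof (cases "lo n f = hi n f")
  case True
  then show ?thesis
    unfolding tutte_slice_sum[OF P] by (simp add: algebra_simps)
next
  case False
  then have "{lo n f..hi n f} = insert (lo n f) (insert (hi n f) {lo n f<..<hi n f})"
    using lo_le_hi[OF P] by auto
  moreover have "(\<Sum>t\<in>{lo n f<..<hi n f}. (if t = lo n f then if t = hi n f then var_x + var_y - 1 else var_x
     else if t = hi n f then var_y else 1) * tutte n (slice n P t))
    = (\<Sum>t\<in>{lo n f<..<hi n f}. tutte n (slice n P t))"
    by (intro sum.cong) auto
  ultimately show ?thesis
    using False unfolding tutte_slice_sum[OF P] by (simp add: algebra_simps)
qed

subsection \<open>Coefficients\<close>

lemma xy_coeff_var_x_mult: "xy_coeff i j (var_x * g) = (case i of 0 \<Rightarrow> 0 | Suc i' \<Rightarrow> xy_coeff i' j g)"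
  by (simp add: xy_coeff_def var_x_def split: nat.split)

lemma xy_coeff_var_y_mult: "xy_coeff i j (var_y * g) = (case j of 0 \<Rightarrow> 0 | Suc j' \<Rightarrow> xy_coeff i j' g)"
  by (simp add: xy_coeff_def var_y_def split: nat.split)

lemma xy_coeff_tutte_slice:
  assumes P: "polymatroid (Suc n) f P"
  shows "xy_coeff i j (tutte (Suc n) P) =
    (case i of 0 \<Rightarrow> 0 | Suc i' \<Rightarrow> xy_coeff i' j (tutte n (slice n P (lo n f))))
    + (case j of 0 \<Rightarrow> 0 | Suc j' \<Rightarrow> xy_coeff i j' (tutte n (slice n P (hi n f))))
    + (\<Sum>t\<in>{lo n f<..<hi n f}. xy_coeff i j (tutte n (slice n P t)))
    - (if lo n f = hi n f then xy_coeff i j (tutte n (slice n P (lo n f))) else 0)"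
proof -
  have add: "xy_coeff i j (p + q) = xy_coeff i j p + xy_coeff i j q"
    and diff: "xy_coeff i j (p - q) = xy_coeff i j p - xy_coeff i j q"
    and zero: "xy_coeff i j 0 = 0"
    and sum: "xy_coeff i j (sum h A) = (\<Sum>t\<in>A. xy_coeff i j (h t))" for p q and h :: "int \<Rightarrow> _" and A
    by (simp_all add: xy_coeff_def coeff_sum)
  show ?thesis
    unfolding tutte_slice[OF P] add diff sum xy_coeff_var_x_mult xy_coeff_var_y_mult
    by (simp add: zero)
qed

section \<open>Sums of a set function over subsets of fixed size\<close>

definition level_sum :: "nat \<Rightarrow> (nat set \<Rightarrow> int) \<Rightarrow> nat \<Rightarrow> int" where
  "level_sum n f m = (\<Sum>S | S \<subseteq> {1..n} \<and> card S = m. f S)"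

lemma level_sum_cong:
  "(\<And>S. S \<subseteq> {1..n} \<Longrightarrow> f S = g S) \<Longrightarrow> level_sum n f m = level_sum n g m"
  unfolding level_sum_def by (intro sum.cong) auto

lemma level_sum_0 [simp]: "level_sum n f 0 = f {}"
proof -
  have "{S. S \<subseteq> {1..n} \<and> card S = 0} = {{}}"
    using finite_subset by fastforce
  then show ?thesis by (simp add: level_sum_def)
qed

lemma level_sum_full [simp]: "level_sum n f n = f {1..n}"
proof -
  have "S = {1..n}" if "S \<subseteq> {1..n}" "card S = n" for S
    using that by (intro card_subset_eq) simp_all
  then have "{S. S \<subseteq> {1..n} \<and> card S = n} = {{1..n}}"
    by (intro equalityI subsetI) simp_all
  then show ?thesis by (simp add: level_sum_def)
qed

lemma level_sum_above: "level_sum n f (Suc n) = 0"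
proof -
  have "card S \<noteq> Suc n" if "S \<subseteq> {1..n}" for S
    using card_mono[OF finite_atLeastAtMost that] by simp
  then have "{S. S \<subseteq> {1..n} \<and> card S = Suc n} = {}"
    by blast
  then show ?thesis by (simp only: level_sum_def sum.empty)
qed

lemma level_sum_diff_const:
  "level_sum n (\<lambda>S. f S - c) m = level_sum n f m - int (n choose m) * c"
  by (simp add: level_sum_def sum_subtractf n_subsets)

text \<open>Pascal's rule for level sums: split the subsets by whether they contain
  \<open>Suc n\<close>.\<close>

lemma level_sum_Suc:
  "level_sum (Suc n) f (Suc m) = level_sum n f (Suc m) + level_sum n (\<lambda>S. f (insert (Suc n) S)) m"
proof -
  let ?A = "{S. S \<subseteq> {1..n} \<and> card S = Suc m}" and ?B = "{S. S \<subseteq> {1..n} \<and> card S = m}"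
  have fin: "finite {S. S \<subseteq> {1..n} \<and> Q S}" for Q
    by (rule finite_subset[of _ "Pow {1..n}"]) auto
  have "{S. S \<subseteq> {1..Suc n} \<and> card S = Suc m} = ?A \<union> insert (Suc n) ` ?B"
  proof (intro set_eqI iffI)
    fix S assume S: "S \<in> {S. S \<subseteq> {1..Suc n} \<and> card S = Suc m}"
    show "S \<in> ?A \<union> insert (Suc n) ` ?B"
    proof (cases "Suc n \<in> S")
      case True
      moreover have "S - {Suc n} \<subseteq> {1..n}" "card (S - {Suc n}) = m"
        using S True by (auto simp: le_Suc_eq)
      ultimately show ?thesis
        by (intro UnI2 image_eqI[of _ _ "S - {Suc n}"]) auto
    next
      case False
      then have "S \<subseteq> {1..n}" using S by (fastforce simp: le_Suc_eq)
      then show ?thesis using S by auto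
    qed
  next
    fix S assume "S \<in> ?A \<union> insert (Suc n) ` ?B"
    then show "S \<in> {S. S \<subseteq> {1..Suc n} \<and> card S = Suc m}"
    proof
      assume "S \<in> insert (Suc n) ` ?B"
      then obtain T where T: "S = insert (Suc n) T" "T \<subseteq> {1..n}" "card T = m" by auto
      then have "Suc n \<notin> T" "finite T" using finite_subset by auto
      then show ?thesis using T by auto
    qed auto
  qed
  moreover have "?A \<inter> insert (Suc n) ` ?B = {}" by auto
  moreover have "inj_on (insert (Suc n)) ?B"
  proof (rule inj_onI)
    fix S T assume "S \<in> ?B" "T \<in> ?B" "insert (Suc n) S = insert (Suc n) T"
    moreover from this have "Suc n \<notin> S" "Suc n \<notin> T" by auto
    ultimately show "S = T" by (metis insert_ident)
  qed
  ultimately show ?thesis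
    using fin by (simp add: level_sum_def sum.union_disjoint sum.reindex)
qed

section \<open>Recursion for the claimed formula\<close>

text \<open>The right-hand side of the claim with \<open>k = Suc j\<close>: \<open>j\<close> is the
  exponent of \<open>y\<close>, and truncated subtraction is avoided.\<close>

definition subleading :: "nat \<Rightarrow> (nat set \<Rightarrow> int) \<Rightarrow> nat \<Rightarrow> int" where
  "subleading n f j = level_sum n f j + level_sum n f (Suc j)
     - int (n choose j) * f {1..n} - int (Suc j) * int (n choose Suc j)"

text \<open>Matches the coefficient recursion of \<open>tutte\<close>: the \<open>lo\<close> slice
  keeps \<open>j\<close>, the \<open>hi\<close> slice lowers it, and the other terms contribute top
  coefficients. The case \<open>j = n\<close> is that of exponent 0 for \<open>x\<close>.\<close>

lemma subleading_Suc:
  assumes P: "polymatroid (Suc n) f P" and "j \<le> n"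
  shows "subleading (Suc n) f j =
    (if j = n then 0 else subleading n (slice_rank n f (lo n f)) j)
    + (case j of 0 \<Rightarrow> 0 | Suc j' \<Rightarrow> subleading n (slice_rank n f (hi n f)) j')
    + int (n choose j) * (hi n f - lo n f - 1)"
proof -
  \<comment> \<open>Submodularity decides the minimum at the ends: \<open>lo\<close> gives the
    restriction of \<open>f\<close> to subsets of \<open>{1..n}\<close>, \<open>hi\<close> the
    contraction by \<open>Suc n\<close>.\<close>
  have lo_rank: "slice_rank n f (lo n f) S = f S" if "S \<subseteq> {1..n}" for S
    using submodular_insert[OF P that, of "{1..n}"] that
    by (simp add: slice_rank_def lo_def insert_Suc_atLeastAtMost Un_absorb1 Int_absorb2 del: One_nat_def)
  have hi_rank: "slice_rank n f (hi n f) S = f (insert (Suc n) S) - hi n f" if "S \<subseteq> {1..n}" for S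
    using submodular_insert[OF P, of "{}" S] that polymatroidD(1)[OF P]
    by (simp add: slice_rank_def hi_def)
  \<comment> \<open>This removes the case distinction: at \<open>j = n\<close> the level sums
    \<open>f {1..n}\<close> and 0 cancel against the binomial terms.\<close>
  have "subleading n f n = 0"
    by (simp add: subleading_def level_sum_above)
  then have sub_lo: "(if j = n then 0 else subleading n (slice_rank n f (lo n f)) j) = subleading n f j"
    using level_sum_cong[OF lo_rank] lo_rank[of "{1..n}"] by (simp add: subleading_def)
  have sub_hi: "subleading n (slice_rank n f (hi n f)) j' =
      level_sum n (\<lambda>S. f (insert (Suc n) S)) j' - int (n choose j') * hi n f
      + (level_sum n (\<lambda>S. f (insert (Suc n) S)) (Suc j') - int (n choose Suc j') * hi n f)
      - int (n choose j') * (f {1..Suc n} - hi n f) - int (Suc j') * int (n choose Suc j')" for j'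
    using hi_rank[of "{1..n}"]
    by (simp only: subleading_def level_sum_cong[OF hi_rank] level_sum_diff_const
        insert_Suc_atLeastAtMost subset_refl)
  show ?thesis
  proof (cases j)
    case 0
    then show ?thesis
      unfolding sub_lo using polymatroidD(1)[OF P]
      by (simp add: subleading_def level_sum_Suc hi_def lo_def algebra_simps)
  next
    case (Suc j')
    show ?thesis
      unfolding sub_lo unfolding Suc nat.case sub_hi
      by (simp add: subleading_def level_sum_Suc lo_def algebra_simps del: One_nat_def)
  qed
qed

text \<open>One joint induction is used because a coefficient of total degree \<open>d\<close> draws
  on degree \<open>d - 1\<close> in the end slices but on degree \<open>d\<close> in the interior
  ones.\<close>

lemma xy_coeff_tutte:
  assumes "polymatroid n f P"
  shows "i + j > n \<Longrightarrow> xy_coeff i j (tutte n P) = 0"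
    and "i + j = n \<Longrightarrow> xy_coeff i j (tutte n P) = int (n choose j)"
    and "Suc (i + j) = n \<Longrightarrow> xy_coeff i j (tutte n P) = subleading n f j"
proof -
  have "(i + j > n \<longrightarrow> xy_coeff i j (tutte n P) = 0) \<and>
    (i + j = n \<longrightarrow> xy_coeff i j (tutte n P) = int (n choose j)) \<and>
    (Suc (i + j) = n \<longrightarrow> xy_coeff i j (tutte n P) = subleading n f j)"
    using assms
  proof (induction n arbitrary: f P i j)
    case 0
    \<comment> \<open>For \<open>n = 0\<close> the origin is the only lattice point, and it
      satisfies the constraints since \<open>f {} = 0\<close>.\<close>
    then have "P = {\<lambda>_. 0}"
      using polymatroidD(1)[OF 0] by (auto simp: polymatroidD(3)[OF 0] lattice_points_def)
    then have "tutte 0 P = 1"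
      by (simp add: tutte_def internally_active_def externally_active_def)
    then show ?case by (cases i; cases j) (simp_all add: xy_coeff_def)
  next
    case (Suc n)
    note P = Suc.prems
    have IH: "i + j > n \<Longrightarrow> xy_coeff i j (tutte n (slice n P t)) = 0"
      "i + j = n \<Longrightarrow> xy_coeff i j (tutte n (slice n P t)) = int (n choose j)"
      "Suc (i + j) = n \<Longrightarrow> xy_coeff i j (tutte n (slice n P t)) = subleading n (slice_rank n f t) j"
      if "t \<in> {lo n f..hi n f}" for t i j
      using Suc.IH[OF polymatroid_slice[OF P that], of i j] by simp_all
    have lh: "lo n f \<in> {lo n f..hi n f}" "hi n f \<in> {lo n f..hi n f}"
      using lo_le_hi[OF P] by auto
    note IH_lo = IH[OF lh(1)] and IH_hi = IH[OF lh(2)]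
    have mid_high: "(\<Sum>t\<in>{lo n f<..<hi n f}. xy_coeff i j (tutte n (slice n P t))) = 0" if "i + j > n"
      using that by (intro sum.neutral ballI IH(1)) auto
    \<comment> \<open>For \<open>lo < hi\<close> there are \<open>hi - lo - 1\<close> interior
      slices with equal top coefficient; for \<open>lo = hi\<close> the correction supplies the
      factor -1.\<close>
    have mid_top: "(\<Sum>t\<in>{lo n f<..<hi n f}. xy_coeff i j (tutte n (slice n P t)))
        - (if lo n f = hi n f then xy_coeff i j (tutte n (slice n P (lo n f))) else 0)
        = int (n choose j) * (hi n f - lo n f - 1)" if "i + j = n"
    proof -
      have "(\<Sum>t\<in>{lo n f<..<hi n f}. xy_coeff i j (tutte n (slice n P t)))
          = (\<Sum>t\<in>{lo n f<..<hi n f}. int (n choose j))"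
        using that by (intro sum.cong refl IH(2)) auto
      then show ?thesis
        using that IH_lo(2)[of i j] lo_le_hi[OF P] by (auto simp: of_nat_nat)
    qed
    show ?case
    proof (intro conjI impI)
      assume "i + j > Suc n"
      then show "xy_coeff i j (tutte (Suc n) P) = 0"
        unfolding xy_coeff_tutte_slice[OF P]
        by (simp add: mid_high IH_lo(1) IH_hi(1) split: nat.split)
    next
      assume ij: "i + j = Suc n"
      then have "xy_coeff i j (tutte (Suc n) P) =
          (case i of 0 \<Rightarrow> 0 | Suc i' \<Rightarrow> xy_coeff i' j (tutte n (slice n P (lo n f))))
          + (case j of 0 \<Rightarrow> 0 | Suc j' \<Rightarrow> xy_coeff i j' (tutte n (slice n P (hi n f))))"
        unfolding xy_coeff_tutte_slice[OF P] by (auto simp: mid_high IH_lo(1) IH_hi(1))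
      \<comment> \<open>Pascal's rule; for \<open>i = 0\<close> the absent \<open>x\<close> term
        agrees with \<open>n choose Suc n = 0\<close>.\<close>
      then show "xy_coeff i j (tutte (Suc n) P) = int (Suc n choose j)"
        using ij by (cases i; cases j) (simp_all add: IH_lo(2) IH_hi(2) binomial_eq_0)
    next
      assume "Suc (i + j) = Suc n"
      then have ij: "i + j = n" by simp
      have "xy_coeff i j (tutte (Suc n) P) =
          (case i of 0 \<Rightarrow> 0 | Suc i' \<Rightarrow> xy_coeff i' j (tutte n (slice n P (lo n f))))
          + (case j of 0 \<Rightarrow> 0 | Suc j' \<Rightarrow> xy_coeff i j' (tutte n (slice n P (hi n f))))
          + int (n choose j) * (hi n f - lo n f - 1)"
        unfolding xy_coeff_tutte_slice[OF P] mid_top[OF ij, symmetric] by (simp only: add_diff_eq)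
      \<comment> \<open>Since \<open>i + j = n\<close>, the exponent \<open>i\<close> is 0 exactly
        when \<open>j = n\<close>.\<close>
      also have "(case i of 0 \<Rightarrow> 0 | Suc i' \<Rightarrow> xy_coeff i' j (tutte n (slice n P (lo n f)))) =
          (if j = n then 0 else subleading n (slice_rank n f (lo n f)) j)"
        using ij by (cases i) (simp_all add: IH_lo(3))
      also have "(case j of 0 \<Rightarrow> 0 | Suc j' \<Rightarrow> xy_coeff i j' (tutte n (slice n P (hi n f)))) =
          (case j of 0 \<Rightarrow> 0 | Suc j' \<Rightarrow> subleading n (slice_rank n f (hi n f)) j')"
        using ij by (cases j) (simp_all add: IH_hi(3))
      finally show "xy_coeff i j (tutte (Suc n) P) = subleading (Suc n) f j"
        using subleading_Suc[OF P] ij by simp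
    qed
  qed
  then show "i + j > n \<Longrightarrow> xy_coeff i j (tutte n P) = 0"
    and "i + j = n \<Longrightarrow> xy_coeff i j (tutte n P) = int (n choose j)"
    and "Suc (i + j) = n \<Longrightarrow> xy_coeff i j (tutte n P) = subleading n f j"
    by blast+
qed

theorem theorem5p3:
  fixes n k :: nat
    and f :: "nat set \<Rightarrow> int"
    and P :: "(nat \<Rightarrow> int) set"
  assumes "polymatroid n f P"
    and "k \<in> {1..n}"
  shows "xy_coeff (n - k) (k - 1) (tutte n P) =
           (\<Sum>S | S \<subseteq> {1..n} \<and> card S = k - 1. f S)
         + (\<Sum>S' | S' \<subseteq> {1..n} \<and> card S' = k. f S')
         - int (n choose (k - 1)) * f {1..n}
         - int k * int (n choose k)"
proof -
  \<comment> \<open>Here \<open>1 \<le> k \<le> n\<close> ensures that neither natural subtraction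
    truncates.\<close>
  have "Suc (n - k + (k - 1)) = n" "Suc (k - 1) = k"
    using assms(2) by auto
  then show ?thesis
    using xy_coeff_tutte(3)[OF assms(1), of "n - k" "k - 1"]
    by (simp add: subleading_def level_sum_def)
qed

end
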